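(* Every $\aleph_1$-free abelian group is lcH-slender; that is, if $H$ is an $\aleph_1$-free abelian group, $G$ is a locally compact Hausdorff topological group, and $\phi:G\to H$ is an abstract group homomorphism, then $\ker(\phi)$ is open in $G$.
   Context: An abelian group is $\aleph_1$-free abelian if every countable subgroup is free abelian. A group $H$ is lcH-slender if every abstract homomorphism from a locally compact Hausdorff topological group to $H$ has open kernel. *)

theory Defs
  imports "HOL-Analysis.Analysis" "HOL-Algebra.Algebra"
begin

definition topological_group :: "('g, 'm) monoid_scheme \<Rightarrow> 'g topology \<Rightarrow> bool" where
  "topological_group G T \<longleftrightarrow>
     group G \<and> topspace T = carrier G \<and>
     continuous_map (prod_topology T T) T (\<lambda>(x, y). x \<otimes>\<^bsub>G\<^esub> y) \<and>
     continuous_map T T (\<lambda>x. inv\<^bsub>G\<^esub> x)"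

definition free_abelian_subgroup :: "('h, 'n) monoid_scheme \<Rightarrow> 'h set \<Rightarrow> bool" where
  "free_abelian_subgroup H K \<longleftrightarrow>
     (\<exists>S :: 'h set. subgroup_generated H K \<cong> free_Abelian_group S)"

definition aleph1_free :: "('h, 'n) monoid_scheme \<Rightarrow> bool" where
  "aleph1_free H \<longleftrightarrow> comm_group H \<and>
     (\<forall>K. subgroup K H \<and> countable K \<longrightarrow> free_abelian_subgroup H K)"

end

theory Submission
  imports Defs
begin

text \<open>
  If \<open>h\<^sub>n = a^c\<^sub>n * h\<^sub>n\<^sub>+\<^sub>1^k\<^sub>n\<close> in \<open>H\<close> with \<open>c\<^sub>n \<noteq> 0\<close> and \<open>k\<^sub>n\<close> growing faster than \<open>c\<^sub>n\<close>, then \<open>a\<close> is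
  trivial: the countable subgroup generated by \<open>a\<close> and all \<open>h\<^sub>n\<close> is free, so a nontrivial \<open>a\<close> would
  be detected by a homomorphism to the integers, whose values at \<open>h\<^sub>n\<close> are forced to vanish
  eventually. Preimages of such equations can be solved in \<open>G\<close> by compactness as soon as elements
  \<open>g\<^sub>n\<close> tending rapidly to the identity have \<open>\<phi> g\<^sub>n = a^c\<^sub>n\<close>. Hence every \<open>a\<close> has a neighbourhood of the identity
  on which \<open>\<phi>\<close> takes no nontrivial value in the cyclic group of \<open>a\<close>, and so the kernel is closed.

  One may therefore replace \<open>G\<close> by its image with the quotient topology, which is again a locally
  compact Hausdorff group, and assume \<open>\<phi>\<close> injective. The same equations with constant \<open>g\<^sub>n = g\<close> show
  that the powers of a nontrivial \<open>g\<close> leave every compact set. If \<open>G\<close> were not discrete, take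
  nontrivial elements tending to the identity and their first powers outside a fixed neighbourhood:
  a cluster point of these powers is nontrivial and has roots of every order, which is impossible
  in \<open>H\<close>.
\<close>

section \<open>Integer-valued functionals on countable subgroups\<close>

lemma (in group) countable_generate:
  assumes "countable A" "A \<subseteq> carrier G"
  shows "countable (generate G A)"
proof -
  define Y where "Y = A \<union> m_inv G ` A"
  have "generate G A \<subseteq> (\<lambda>xs. foldr (\<otimes>) xs \<one>) ` lists Y"
  proof
    fix x assume "x \<in> generate G A"
    then show "x \<in> (\<lambda>xs. foldr (\<otimes>) xs \<one>) ` lists Y"
    proof (induction rule: generate.induct)
      case one
      show ?case by (rule image_eqI[of _ _ "[]"]) auto
    next
      case (incl h)
      then show ?case using assms by (intro image_eqI[of _ _ "[h]"]) (auto simp: Y_def)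
    next
      case (inv h)
      then show ?case using assms by (intro image_eqI[of _ _ "[inv h]"]) (auto simp: Y_def)
    next
      case (eng h1 h2)
      then obtain xs ys where xs: "xs \<in> lists Y" "h1 = foldr (\<otimes>) xs \<one>"
        and ys: "ys \<in> lists Y" "h2 = foldr (\<otimes>) ys \<one>" by auto
      have Y: "Y \<subseteq> carrier G" using assms by (auto simp: Y_def)
      have closed: "foldr (\<otimes>) zs \<one> \<in> carrier G" if "zs \<in> lists Y" for zs
        using that Y by (induction zs) auto
      have "foldr (\<otimes>) (xs @ ys) \<one> = foldr (\<otimes>) xs \<one> \<otimes> foldr (\<otimes>) ys \<one>"
        using xs(1)
      proof (induction xs)
        case (Cons z zs)
        then show ?case using Y closed[of zs] closed[OF ys(1)] by (auto simp: m_assoc)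
      qed (use closed[OF ys(1)] in simp)
      then show ?case using xs ys by (intro image_eqI[of _ _ "xs @ ys"]) auto
    qed
  qed
  moreover have "countable (lists Y)"
    using assms(1) by (auto simp: Y_def)
  ultimately show ?thesis
    by (meson countable_image countable_subset)
qed

text \<open>The subgroup generated by \<open>A\<close> is countable, hence free abelian, and a
  nonzero element of a free abelian group has a nonzero coordinate; \<open>f\<close> is such a
  coordinate. Additivity is claimed only on \<open>K\<close>, since the isomorphism says nothing
  outside it.\<close>

lemma aleph1_free_separating_functional:
  fixes H :: "('h, 'n) monoid_scheme"
  assumes H: "aleph1_free H" and A: "countable A" "A \<subseteq> carrier H"
    and a: "a \<in> A" "a \<noteq> \<one>\<^bsub>H\<^esub>"
  obtains f :: "'h \<Rightarrow> int" and K where "subgroup K H" "A \<subseteq> K" "f a \<noteq> 0"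
    "\<And>x y. x \<in> K \<Longrightarrow> y \<in> K \<Longrightarrow> f (x \<otimes>\<^bsub>H\<^esub> y) = f x + f y"
proof -
  interpret comm_group H using H by (simp add: aleph1_free_def)
  define K where "K = generate H A"
  have K: "subgroup K H" "A \<subseteq> K" "countable K"
    using A generate_is_subgroup countable_generate by (auto simp: K_def generate.incl)
  interpret K: subgroup K H by fact
  obtain S :: "'h set" and \<psi> where \<psi>: "\<psi> \<in> iso (subgroup_generated H K) (free_Abelian_group S)"
    using H K unfolding aleph1_free_def free_abelian_subgroup_def is_iso_def by blast
  have hom: "\<psi> \<in> hom (subgroup_generated H K) (free_Abelian_group S)"
    and inj: "inj_on \<psi> K"
    using \<psi> by (auto simp: iso_def bij_betw_def)
  have add: "\<psi> (x \<otimes>\<^bsub>H\<^esub> y) = \<psi> x + \<psi> y" if "x \<in> K" "y \<in> K" for x y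
    using hom that by (auto simp: hom_def free_Abelian_group_def)
  have "\<psi> \<one>\<^bsub>H\<^esub> = 0"
    using add[of "\<one>\<^bsub>H\<^esub>" "\<one>\<^bsub>H\<^esub>"] by simp
  then have "\<psi> a \<noteq> 0"
    using inj a K(2) K.one_closed by (metis inj_onD subsetD)
  then obtain s where "Poly_Mapping.lookup (\<psi> a) s \<noteq> 0"
    by (metis lookup_zero poly_mapping_eqI)
  then show thesis
    using that[of K "\<lambda>x. Poly_Mapping.lookup (\<psi> x) s"] K add by (auto simp: lookup_add)
qed

lemma (in group) additive_nat_pow:
  fixes f :: "'a \<Rightarrow> int" and n :: nat
  assumes K: "subgroup K G" and f: "\<And>x y. x \<in> K \<Longrightarrow> y \<in> K \<Longrightarrow> f (x \<otimes> y) = f x + f y"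
    and x: "x \<in> K"
  shows "x [^] n \<in> K" "f (x [^] n) = int n * f x"
proof -
  interpret K: subgroup K G by fact
  have "f \<one> = 0" using f[of \<one> \<one>] by simp
  then have "x [^] n \<in> K \<and> f (x [^] n) = int n * f x"
    by (induction n) (use x f in \<open>auto simp: algebra_simps\<close>)
  then show "x [^] n \<in> K" "f (x [^] n) = int n * f x" by auto
qed

lemma (in group) additive_int_pow:
  fixes f :: "'a \<Rightarrow> int" and k :: int
  assumes K: "subgroup K G" and f: "\<And>x y. x \<in> K \<Longrightarrow> y \<in> K \<Longrightarrow> f (x \<otimes> y) = f x + f y"
    and x: "x \<in> K"
  shows "x [^] k \<in> K" "f (x [^] k) = k * f x"
proof -
  interpret K: subgroup K G by fact
  note n = additive_nat_pow[OF K f x]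
  have "f \<one> = 0" using f[of \<one> \<one>] by simp
  then have inv: "f (inv y) = - f y" if "y \<in> K" for y
    using f[of "inv y" y] that by (simp add: K.m_inv_closed)
  have "x [^] k \<in> K \<and> f (x [^] k) = k * f x"
  proof (cases k rule: int_cases2)
    case (nonneg m)
    then show ?thesis using n by (simp add: int_pow_int)
  next
    case (nonpos m)
    then have "x [^] k = inv (x [^] m)"
      using x by (simp add: int_pow_neg int_pow_int)
    then show ?thesis using n[of m] inv[OF n(1)] nonpos by (simp add: K.m_inv_closed)
  qed
  then show "x [^] k \<in> K" "f (x [^] k) = k * f x" by auto
qed

section \<open>Equations with only trivial solutions in an aleph1-free group\<close>

text \<open>Choosing one root of each order keeps the set of elements countable. A functional that
  is nonzero at \<open>a\<close> would then give a nonzero integer divisible by every positive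
  integer.\<close>

lemma aleph1_free_infinitely_divisible:
  assumes H: "aleph1_free H" and a: "a \<in> carrier H"
    and div: "\<And>n::nat. n > 0 \<Longrightarrow> \<exists>h\<in>carrier H. h [^]\<^bsub>H\<^esub> n = a"
  shows "a = \<one>\<^bsub>H\<^esub>"
proof (rule ccontr)
  assume "a \<noteq> \<one>\<^bsub>H\<^esub>"
  interpret comm_group H using H by (simp add: aleph1_free_def)
  obtain h where h: "\<And>n::nat. n > 0 \<Longrightarrow> h n \<in> carrier H \<and> h n [^]\<^bsub>H\<^esub> n = a"
    using div by metis
  obtain f :: "_ \<Rightarrow> int" and K where K: "subgroup K H" "insert a (h ` {0<..}) \<subseteq> K" "f a \<noteq> 0"
    and f: "\<And>x y. x \<in> K \<Longrightarrow> y \<in> K \<Longrightarrow> f (x \<otimes>\<^bsub>H\<^esub> y) = f x + f y"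
  proof (rule aleph1_free_separating_functional[OF H, of "insert a (h ` {0<..})" a])
    show "insert a (h ` {0<..}) \<subseteq> carrier H" using a h by auto
  qed (use \<open>a \<noteq> \<one>\<^bsub>H\<^esub>\<close> in auto)
  \<comment> \<open>A divisor exceeding \<open>\<bar>f a\<bar>\<close> is enough for the
    contradiction.\<close>
  define n where "n = Suc (nat \<bar>f a\<bar>)"
  have "h n \<in> K" "h n [^]\<^bsub>H\<^esub> n = a"
    using K(2) h[of n] by (auto simp: n_def simp del: nat_pow_Suc)
  then have "f a = int n * f (h n)"
    using additive_nat_pow(2)[OF K(1) f, of "h n" n] by simp
  then have "int n dvd f a" by simp
  then have "int n \<le> \<bar>f a\<bar>"
    using dvd_imp_le_int[OF \<open>f a \<noteq> 0\<close>, of "int n"] by (simp only: abs_of_nat)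
  then show False by (simp add: n_def)
qed

text \<open>The factor \<open>\<bar>c n\<bar> + 1\<close> absorbs the term \<open>c n * m\<close>,
  and the factor \<open>int n + 2\<close> then forces the bounded integers \<open>y n\<close> to
  vanish from some index on, where the recurrence reduces to \<open>c n * m = 0\<close>.\<close>

lemma int_recurrence_zero:
  fixes y c :: "nat \<Rightarrow> int" and m :: int
  assumes rec: "\<And>n. y n = c n * m + (\<bar>c n\<bar> + 1) * (int n + 2) * y (Suc n)"
    and c: "\<And>n. c n \<noteq> 0"
  shows "m = 0"
proof -
  have step: "(int n + 2) * \<bar>y (Suc n)\<bar> \<le> max \<bar>y n\<bar> \<bar>m\<bar>" for n
  proof -
    let ?z = "max \<bar>y n\<bar> \<bar>m\<bar>"
    have "(\<bar>c n\<bar> + 1) * ((int n + 2) * \<bar>y (Suc n)\<bar>) = \<bar>y n - c n * m\<bar>"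
      by (simp add: rec[of n] abs_mult)
    also have "\<dots> \<le> \<bar>y n\<bar> + \<bar>c n\<bar> * \<bar>m\<bar>"
      by (metis abs_mult abs_triangle_ineq4)
    also have "\<dots> \<le> ?z + \<bar>c n\<bar> * ?z"
      by (intro add_mono mult_left_mono) auto
    also have "\<dots> = (\<bar>c n\<bar> + 1) * ?z"
      by (simp add: algebra_simps)
    finally show ?thesis
      by (simp add: mult_le_cancel_left)
  qed
  define Z where "Z = max \<bar>y 0\<bar> \<bar>m\<bar>"
  have bound: "\<bar>y n\<bar> \<le> Z" for n
  proof (induction n)
    case 0
    show ?case unfolding Z_def by (rule max.cobounded1)
  next
    case (Suc n)
    have "\<bar>y (Suc n)\<bar> \<le> (int n + 2) * \<bar>y (Suc n)\<bar>"
      by (simp add: mult_le_cancel_right1)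
    also have "\<dots> \<le> Z"
      using step[of n] by (rule order_trans) (use Suc in \<open>simp add: Z_def\<close>)
    finally show ?case by simp
  qed
  \<comment> \<open>By \<open>step\<close> and \<open>bound\<close>,
    \<open>\<bar>y (Suc n)\<bar>\<close> is at most \<open>Z / (n + 2) < 1\<close>, and
    \<open>y (Suc n)\<close> is an integer.\<close>
  have zero: "y (Suc n) = 0" if "int n \<ge> Z" for n
  proof (rule ccontr)
    assume "y (Suc n) \<noteq> 0"
    then have "1 \<le> \<bar>y (Suc n)\<bar>" by linarith
    then have "(int n + 2) * 1 \<le> (int n + 2) * \<bar>y (Suc n)\<bar>"
      by (rule mult_left_mono) linarith
    moreover have "\<dots> \<le> Z"
      using step[of n] by (rule order_trans) (use bound[of n] in \<open>simp add: Z_def\<close>)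
    ultimately have "(int n + 2) * 1 \<le> Z" by (rule order_trans)
    then show False using that by simp
  qed
  have "Z \<ge> 0" by (simp add: Z_def)
  \<comment> \<open>Two consecutive zeros are taken because each instance of the recurrence involves
    two neighbouring terms.\<close>
  then have "y (Suc (nat Z)) = 0" "y (Suc (Suc (nat Z))) = 0"
    using zero[of "nat Z"] zero[of "Suc (nat Z)"] by simp_all
  then have "c (Suc (nat Z)) * m = 0"
    using rec[of "Suc (nat Z)"] by (simp only: mult_zero_right add_0_right)
  then show "m = 0"
    using c by simp
qed

text \<open>A functional separating \<open>a\<close> on the countable set of \<open>a\<close> and
  all \<open>h n\<close> turns the equations into the integer recurrence above, with
  \<open>m = f a\<close>.\<close>

lemma aleph1_free_recurrence:
  fixes c :: "nat \<Rightarrow> int" and h :: "nat \<Rightarrow> 'h"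
  assumes H: "aleph1_free H" and a: "a \<in> carrier H" and h: "\<And>n. h n \<in> carrier H"
    and c: "\<And>n. c n \<noteq> 0"
    and rec: "\<And>n. h n = a [^]\<^bsub>H\<^esub> c n \<otimes>\<^bsub>H\<^esub> h (Suc n) [^]\<^bsub>H\<^esub> ((nat \<bar>c n\<bar> + 1) * (n + 2))"
  shows "a = \<one>\<^bsub>H\<^esub>"
proof (rule ccontr)
  assume "a \<noteq> \<one>\<^bsub>H\<^esub>"
  interpret comm_group H using H by (simp add: aleph1_free_def)
  obtain f :: "_ \<Rightarrow> int" and K where K: "subgroup K H" "insert a (range h) \<subseteq> K" "f a \<noteq> 0"
    and f: "\<And>x y. x \<in> K \<Longrightarrow> y \<in> K \<Longrightarrow> f (x \<otimes>\<^bsub>H\<^esub> y) = f x + f y"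
  proof (rule aleph1_free_separating_functional[OF H, of "insert a (range h)" a])
    show "insert a (range h) \<subseteq> carrier H" using a h by auto
  qed (use \<open>a \<noteq> \<one>\<^bsub>H\<^esub>\<close> in auto)
  have hK: "h n \<in> K" and aK: "a \<in> K" for n using K by auto
  have "f (h n) = c n * f a + (\<bar>c n\<bar> + 1) * (int n + 2) * f (h (Suc n))" for n
  proof -
    let ?k = "(nat \<bar>c n\<bar> + 1) * (n + 2)"
    have "f (h n) = f (a [^]\<^bsub>H\<^esub> c n) + f (h (Suc n) [^]\<^bsub>H\<^esub> ?k)"
      using f additive_int_pow(1)[OF K(1) f aK] additive_nat_pow(1)[OF K(1) f hK] rec[of n] by metis
    then have "f (h n) = c n * f a + int ?k * f (h (Suc n))"
      by (simp only: additive_int_pow(2)[OF K(1) f aK] additive_nat_pow(2)[OF K(1) f hK])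
    then show ?thesis by (simp add: algebra_simps)
  qed
  then have "f a = 0"
    using c by (rule int_recurrence_zero)
  then show False using K(3) by contradiction
qed

section \<open>Inverse limits of compact sets\<close>

text \<open>Let \<open>L n\<close> be the points of \<open>C n\<close> that lie in the image of
  every later set. By compactness \<open>L 0\<close> is nonempty and each point of
  \<open>L n\<close> lifts to \<open>L (Suc n)\<close>, so dependent choice builds a compatible
  sequence.\<close>

lemma compact_inverse_limit_nonempty:
  assumes T: "Hausdorff_space T" and C: "\<And>n::nat. compactin T (C n)" "\<And>n. C n \<noteq> {}"
    and p: "\<And>n. continuous_map T T (p n)" "\<And>n. p n ` C (Suc n) \<subseteq> C n"
  shows "\<exists>x. \<forall>n. x n \<in> C n \<and> x n = p n (x (Suc n))"
proof -
  \<comment> \<open>\<open>D k n\<close> is the image of \<open>C (n + k)\<close> in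
    \<open>C n\<close> under the composite of \<open>p n\<close> up to
    \<open>p (n + k - 1)\<close>.\<close>
  define D where "D = rec_nat C (\<lambda>_ E n. p n ` E (Suc n))"
  have D0: "D 0 n = C n" and DS: "D (Suc k) n = p n ` D k (Suc n)" for n k
    by (simp_all add: D_def)
  have sub: "D (Suc k) n \<subseteq> D k n" for k n
  proof (induction k arbitrary: n)
    case (Suc k)
    then show ?case by (metis DS image_mono)
  qed (simp add: D0 DS p)
  have comp: "compactin T (D k n)" for k n
    by (induction k arbitrary: n) (simp_all add: D0 DS C(1) image_compactin[OF _ p(1)])
  have ne: "D k n \<noteq> {}" for k n
    by (induction k arbitrary: n) (use C in \<open>auto simp: D0 DS\<close>)
  \<comment> \<open>Cantor's intersection theorem, with \<open>E 0\<close> as the compact set in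
    which the finite intersection property is used.\<close>
  have nest: "(\<Inter>k. E k) \<noteq> {}"
    if E: "\<And>k::nat. compactin T (E k)" "\<And>k. E k \<noteq> {}" "\<And>k. E (Suc k) \<subseteq> E k" for E
  proof -
    have dec: "E j \<subseteq> E i" if "i \<le> j" for i j
      using that E(3) by (metis lift_Suc_antimono_le)
    have "(E 0) \<inter> \<Inter>(range E) \<noteq> {}"
    proof (rule compactin_fip[THEN iffD1, OF E(1), THEN conjunct2, rule_format])
      show "(\<forall>C\<in>range E. closedin T C) \<and>
        (\<forall>\<F>. finite \<F> \<and> \<F> \<subseteq> range E \<longrightarrow> E 0 \<inter> \<Inter>\<F> \<noteq> {})"
      proof (intro conjI ballI allI impI)
        show "closedin T C" if "C \<in> range E" for C
          using that E(1) T compactin_imp_closedin by auto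
        fix \<F> assume "finite \<F> \<and> \<F> \<subseteq> range E"
        then obtain I where I: "finite I" "\<F> = E ` I" by (meson finite_subset_image)
        have "E (Max (insert 0 I)) \<subseteq> E i" if "i \<in> insert 0 I" for i
          using dec I(1) that by (meson Max_ge finite_insert)
        then have "E (Max (insert 0 I)) \<subseteq> E 0 \<inter> \<Inter>\<F>"
          using I by auto
        then show "E 0 \<inter> \<Inter>\<F> \<noteq> {}" using E(2) by blast
      qed
    qed
    then show ?thesis by auto
  qed
  define L where "L n = (\<Inter>k. D k n)" for n
  have "\<exists>y\<in>L (Suc n). x = p n y" if x: "x \<in> L n" for n x
  proof -
    \<comment> \<open>The fibre of \<open>p n\<close> over \<open>x\<close> meets each
      \<open>D k (Suc n)\<close> because \<open>x\<close> lies in \<open>D (Suc k) n\<close>; a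
      common point is the required lift.\<close>
    define E where "E k = D k (Suc n) \<inter> {y \<in> topspace T. p n y = x}" for k
    have "x \<in> topspace T"
      using x comp[of 0 n] compactin_subset_topspace by (fastforce simp: L_def)
    then have "closedin T {x}"
      using T by (simp add: closedin_Hausdorff_singleton)
    then have cl: "closedin T {y \<in> topspace T. p n y \<in> {x}}"
      by (rule closedin_continuous_map_preimage[OF p(1)])
    have "(\<Inter>k. E k) \<noteq> {}"
    proof (rule nest)
      show "compactin T (E k)" for k
        using compact_Int_closedin[OF comp cl] by (simp add: E_def)
      show "E k \<noteq> {}" for k
      proof -
        have "x \<in> D (Suc k) n" using x by (auto simp: L_def)
        then obtain y where "y \<in> D k (Suc n)" "x = p n y" by (auto simp: DS)
        then show ?thesis
          using compactin_subset_topspace[OF comp[of k "Suc n"]] by (auto simp: E_def)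
      qed
      show "E (Suc k) \<subseteq> E k" for k
        using sub[of k "Suc n"] by (auto simp: E_def)
    qed
    then show ?thesis by (auto simp: E_def L_def)
  qed
  moreover have "\<exists>x. x \<in> L 0"
    using nest[of "\<lambda>k. D k 0", OF comp ne sub] by (auto simp: L_def)
  ultimately have "\<exists>x. \<forall>n. x n \<in> L n \<and> x n = p n (x (Suc n))"
    using dependent_nat_choice[of "\<lambda>n x. x \<in> L n" "\<lambda>n x y. x = p n y"] by blast
  moreover have "L n \<subseteq> C n" for n
    using D0[of n] by (auto simp: L_def)
  ultimately show ?thesis by blast
qed

section \<open>Continuity of the group operations\<close>

lemma topological_group_continuous_mult:
  assumes "topological_group G T" "continuous_map Y T f" "continuous_map Y T g"
  shows "continuous_map Y T (\<lambda>x. f x \<otimes>\<^bsub>G\<^esub> g x)"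
proof -
  have "continuous_map Y (prod_topology T T) (\<lambda>x. (f x, g x))"
    using assms by (simp add: continuous_map_pairedI)
  moreover have "continuous_map (prod_topology T T) T (\<lambda>(x, y). x \<otimes>\<^bsub>G\<^esub> y)"
    using assms by (simp add: topological_group_def)
  ultimately have "continuous_map Y T ((\<lambda>(x, y). x \<otimes>\<^bsub>G\<^esub> y) \<circ> (\<lambda>x. (f x, g x)))"
    by (rule continuous_map_compose)
  then show ?thesis by (simp add: o_def)
qed

lemma topological_group_continuous_inv:
  assumes "topological_group G T" "continuous_map Y T f"
  shows "continuous_map Y T (\<lambda>x. inv\<^bsub>G\<^esub> f x)"
proof -
  have "continuous_map T T (\<lambda>x. inv\<^bsub>G\<^esub> x)"
    using assms by (simp add: topological_group_def)
  then have "continuous_map Y T ((\<lambda>x. inv\<^bsub>G\<^esub> x) \<circ> f)"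
    by (rule continuous_map_compose[OF assms(2)])
  then show ?thesis by (simp add: o_def)
qed

lemma topological_group_continuous_nat_pow:
  assumes "topological_group G T" "continuous_map Y T f"
  shows "continuous_map Y T (\<lambda>x. f x [^]\<^bsub>G\<^esub> (n::nat))"
proof (induction n)
  case 0
  interpret group G using assms by (simp add: topological_group_def)
  have "\<one>\<^bsub>G\<^esub> \<in> topspace T" using assms by (simp add: topological_group_def)
  then show ?case by simp
next
  case (Suc n)
  then show ?case using topological_group_continuous_mult[OF assms(1) Suc assms(2)] by simp
qed

text \<open>Continuity of the quotient of two elements, in terms of open boxes. It yields small
  neighbourhoods of the identity, perturbations of a point outside a closed set, and separation of
  points in a quotient.\<close>

lemma topological_group_diff_nhds:
  assumes G: "topological_group G T" and U: "openin T U"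
    and xy: "x \<in> carrier G" "y \<in> carrier G" "x \<otimes>\<^bsub>G\<^esub> inv\<^bsub>G\<^esub> y \<in> U"
  obtains A B where "openin T A" "openin T B" "x \<in> A" "y \<in> B"
    "\<And>u v. u \<in> A \<Longrightarrow> v \<in> B \<Longrightarrow> u \<otimes>\<^bsub>G\<^esub> inv\<^bsub>G\<^esub> v \<in> U"
proof -
  have top: "topspace T = carrier G" using G by (simp add: topological_group_def)
  have "continuous_map (prod_topology T T) T (\<lambda>p. fst p \<otimes>\<^bsub>G\<^esub> inv\<^bsub>G\<^esub> snd p)"
    by (intro topological_group_continuous_mult topological_group_continuous_inv G
        continuous_map_fst continuous_map_snd)
  then have "openin (prod_topology T T)
      {p \<in> topspace (prod_topology T T). fst p \<otimes>\<^bsub>G\<^esub> inv\<^bsub>G\<^esub> snd p \<in> U}"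
    using U by (rule openin_continuous_map_preimage)
  then have "\<exists>A B. openin T A \<and> openin T B \<and> x \<in> A \<and> y \<in> B \<and>
      A \<times> B \<subseteq> {p \<in> topspace (prod_topology T T). fst p \<otimes>\<^bsub>G\<^esub> inv\<^bsub>G\<^esub> snd p \<in> U}"
    using xy top unfolding openin_prod_topology_alt by auto
  then obtain A B where "openin T A" "openin T B" "x \<in> A" "y \<in> B"
      "A \<times> B \<subseteq> {p \<in> topspace (prod_topology T T). fst p \<otimes>\<^bsub>G\<^esub> inv\<^bsub>G\<^esub> snd p \<in> U}"
    by blast
  then show thesis by (intro that[of A B]) auto
qed

lemma topological_group_square_nhd:
  assumes G: "topological_group G T" and U: "openin T U" "\<one>\<^bsub>G\<^esub> \<in> U"
  obtains V where "openin T V" "\<one>\<^bsub>G\<^esub> \<in> V" "\<And>u v. u \<in> V \<Longrightarrow> v \<in> V \<Longrightarrow> u \<otimes>\<^bsub>G\<^esub> v \<in> U"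
proof -
  interpret group G using G by (simp add: topological_group_def)
  have top: "topspace T = carrier G" using G by (simp add: topological_group_def)
  obtain A B where AB: "openin T A" "openin T B" "\<one>\<^bsub>G\<^esub> \<in> A" "\<one>\<^bsub>G\<^esub> \<in> B"
    "\<And>u v. u \<in> A \<Longrightarrow> v \<in> B \<Longrightarrow> u \<otimes>\<^bsub>G\<^esub> inv\<^bsub>G\<^esub> v \<in> U"
    using topological_group_diff_nhds[OF G U(1), of "\<one>\<^bsub>G\<^esub>" "\<one>\<^bsub>G\<^esub>"] U(2) by auto
  have "continuous_map T T (\<lambda>x. inv\<^bsub>G\<^esub> x)"
    using G by (simp add: topological_group_def)
  then have "openin T {x \<in> topspace T. inv\<^bsub>G\<^esub> x \<in> B}"
    using AB(2) by (rule openin_continuous_map_preimage)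
  \<comment> \<open>Pulling \<open>B\<close> back along inversion replaces the quotient of
    \<open>u\<close> and \<open>v\<close> by their product.\<close>
  then have "openin T (A \<inter> {x \<in> topspace T. inv\<^bsub>G\<^esub> x \<in> B})"
    using AB(1) by blast
  then show thesis
    by (rule that) (use AB top in \<open>force+\<close>)
qed

section \<open>Compact recursions and closedness of the kernel\<close>

text \<open>The maps in \<open>maps\<close> form an inverse system of compact sets. A compatible
  sequence solves the recursion in \<open>G\<close>, and its image under \<open>\<phi>\<close>
  satisfies the hypotheses of \<open>aleph1_free_recurrence\<close>.\<close>

lemma hom_compact_recursion_trivial:
  fixes c :: "nat \<Rightarrow> int"
  assumes H: "aleph1_free H" and G: "topological_group G T" and T: "Hausdorff_space T"
    and \<phi>: "\<phi> \<in> hom G H" and a: "a \<in> carrier H"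
    and C: "\<And>n. compactin T (C n)" "\<And>n. C n \<noteq> {}"
    and g: "\<And>n. g n \<in> carrier G" "\<And>n. \<phi> (g n) = a [^]\<^bsub>H\<^esub> c n" "\<And>n. c n \<noteq> 0"
    and maps: "\<And>n z. z \<in> C (Suc n) \<Longrightarrow>
      g n \<otimes>\<^bsub>G\<^esub> z [^]\<^bsub>G\<^esub> ((nat \<bar>c n\<bar> + 1) * (n + 2)) \<in> C n"
  shows "a = \<one>\<^bsub>H\<^esub>"
proof -
  have top: "topspace T = carrier G" using G by (simp add: topological_group_def)
  interpret group_hom G H \<phi>
    using G H \<phi> by (simp add: group_hom_def group_hom_axioms_def topological_group_def
        aleph1_free_def comm_group.axioms(2))
  define p where "p n z = g n \<otimes>\<^bsub>G\<^esub> z [^]\<^bsub>G\<^esub> ((nat \<bar>c n\<bar> + 1) * (n + 2))" for n z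
  have cont: "continuous_map T T (p n)" for n
    unfolding p_def
    by (intro topological_group_continuous_mult[OF G] topological_group_continuous_nat_pow[OF G])
      (use g top in auto)
  have "p n ` C (Suc n) \<subseteq> C n" for n
    using maps[of _ n] by (auto simp only: p_def)
  then have "\<exists>x. \<forall>n. x n \<in> C n \<and> x n = p n (x (Suc n))"
    by (rule compact_inverse_limit_nonempty[OF T C cont])
  then obtain x where x: "\<And>n. x n \<in> C n" "\<And>n. x n = p n (x (Suc n))"
    by blast
  have xG: "x n \<in> carrier G" for n
    using x(1) C(1) compactin_subset_topspace top by blast
  show ?thesis
  proof (rule aleph1_free_recurrence[OF H a])
    show "\<phi> (x n) = a [^]\<^bsub>H\<^esub> c n \<otimes>\<^bsub>H\<^esub>
        \<phi> (x (Suc n)) [^]\<^bsub>H\<^esub> ((nat \<bar>c n\<bar> + 1) * (n + 2))" for n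
    proof -
      let ?k = "(nat \<bar>c n\<bar> + 1) * (n + 2)"
      have "\<phi> (x n) = \<phi> (g n \<otimes>\<^bsub>G\<^esub> x (Suc n) [^]\<^bsub>G\<^esub> ?k)"
        using x(2)[of n] by (simp only: p_def)
      also have "\<dots> = \<phi> (g n) \<otimes>\<^bsub>H\<^esub> \<phi> (x (Suc n)) [^]\<^bsub>H\<^esub> ?k"
        by (simp only: hom_mult hom_nat_pow g(1) xG G.nat_pow_closed)
      finally show ?thesis by (simp only: g(2))
    qed
  qed (use xG g in auto)
qed

text \<open>Otherwise elements mapped to powers of \<open>a\<close> with nonzero exponent exist
  arbitrarily close to the identity. They can be chosen one after another, together with compact
  neighbourhoods shrinking so fast that the compact recursion applies and makes \<open>a\<close>
  trivial.\<close>

lemma hom_avoids_cyclic_subgroup: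
  fixes G :: "('g, 'm) monoid_scheme" and H :: "('h, 'n) monoid_scheme"
  assumes H: "aleph1_free H" and G: "topological_group G T" and T: "Hausdorff_space T"
    and lc: "locally_compact_space T"
    and \<phi>: "\<phi> \<in> hom G H" and a: "a \<in> carrier H" "a \<noteq> \<one>\<^bsub>H\<^esub>"
  shows "\<exists>V. openin T V \<and> \<one>\<^bsub>G\<^esub> \<in> V \<and> (\<forall>v\<in>V. \<forall>c::int. \<phi> v = a [^]\<^bsub>H\<^esub> c \<longrightarrow> c = 0)"
proof (rule ccontr)
  assume neg: "\<not> ?thesis"
  have ex: "\<exists>v\<in>V. \<exists>c::int. c \<noteq> 0 \<and> \<phi> v = a [^]\<^bsub>H\<^esub> c" if "openin T V" "\<one>\<^bsub>G\<^esub> \<in> V" for V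
  proof (rule ccontr)
    assume "\<not> (\<exists>v\<in>V. \<exists>c::int. c \<noteq> 0 \<and> \<phi> v = a [^]\<^bsub>H\<^esub> c)"
    then have "\<forall>v\<in>V. \<forall>c::int. \<phi> v = a [^]\<^bsub>H\<^esub> c \<longrightarrow> c = 0" by auto
    then show False using that neg by auto
  qed
  interpret G: group G using G by (simp add: topological_group_def)
  have top: "topspace T = carrier G" using G by (simp add: topological_group_def)
  have base: "neighbourhood_base_of (compactin T) T"
    using T lc locally_compact_space_neighbourhood_base by blast
  \<comment> \<open>A stage of the construction: a neighbourhood \<open>W\<close> of the identity
    inside a compact \<open>C\<close>, an element \<open>v\<close> of \<open>W\<close>, and its
    exponent \<open>c\<close>. The relation \<open>R n\<close> links a stage to the next one by
    requiring the recursion map to send the next compact set into the present one.\<close>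
  define P where "P = (\<lambda>(W, C, v, c::int). openin T W \<and> \<one>\<^bsub>G\<^esub> \<in> W \<and> W \<subseteq> C \<and> compactin T C \<and>
      v \<in> W \<and> c \<noteq> 0 \<and> \<phi> v = a [^]\<^bsub>H\<^esub> c)"
  define R where "R = (\<lambda>n (W::'g set, C, v, c::int) (W'::'g set, C', v'::'g, c'::int).
      \<forall>z\<in>C'. v \<otimes>\<^bsub>G\<^esub> z [^]\<^bsub>G\<^esub> ((nat \<bar>c\<bar> + 1) * (n + 2)) \<in> C)"
  have shrink: "\<exists>W C v c. P (W, C, v, c) \<and> C \<subseteq> A" if A: "openin T A" "\<one>\<^bsub>G\<^esub> \<in> A" for A
  proof -
    obtain W C where WC: "openin T W" "compactin T C" "\<one>\<^bsub>G\<^esub> \<in> W" "W \<subseteq> C" "C \<subseteq> A"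
      using base A unfolding neighbourhood_base_of by metis
    obtain v where v: "v \<in> W" "\<exists>c::int. c \<noteq> 0 \<and> \<phi> v = a [^]\<^bsub>H\<^esub> c"
      using ex[OF WC(1,3)] ..
    obtain c :: int where "c \<noteq> 0 \<and> \<phi> v = a [^]\<^bsub>H\<^esub> c" using v(2) ..
    then have "P (W, C, v, c) \<and> C \<subseteq> A" using WC v(1) by (simp add: P_def)
    then show ?thesis by blast
  qed
  have "\<exists>s. \<forall>n. P (s n) \<and> R n (s n) (s (Suc n))"
  proof (rule dependent_nat_choice)
    show "\<exists>s. P s" using shrink[of "topspace T"] top G.one_closed openin_topspace by blast
    fix s n assume s: "P s"
    obtain W C v c where s_eq: "s = (W, C, v, c)" by (cases s)
    then have W: "openin T W" "W \<subseteq> C" "v \<in> W" using s by (auto simp: P_def)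
    then have v: "v \<in> carrier G" using openin_subset top by blast
    \<comment> \<open>The exponent is already fixed by the present stage. The recursion map sends
      the identity to \<open>v\<close> in \<open>W\<close>, so the preimage of \<open>W\<close> is a
      neighbourhood of the identity in which the next stage fits.\<close>
    let ?k = "(nat \<bar>c\<bar> + 1) * (n + 2)"
    have "continuous_map T T (\<lambda>z. v \<otimes>\<^bsub>G\<^esub> z [^]\<^bsub>G\<^esub> ?k)"
      by (intro topological_group_continuous_mult[OF G] topological_group_continuous_nat_pow[OF G])
        (use v top in auto)
    then have "openin T {z \<in> topspace T. v \<otimes>\<^bsub>G\<^esub> z [^]\<^bsub>G\<^esub> ?k \<in> W}"
      using W(1) by (rule openin_continuous_map_preimage)
    moreover have "\<one>\<^bsub>G\<^esub> \<in> {z \<in> topspace T. v \<otimes>\<^bsub>G\<^esub> z [^]\<^bsub>G\<^esub> ?k \<in> W}"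
      using top v W(3) by (simp only: mem_Collect_eq G.one_closed G.nat_pow_one G.r_one)
    ultimately have "\<exists>W' C' v' c'. P (W', C', v', c') \<and>
        C' \<subseteq> {z \<in> topspace T. v \<otimes>\<^bsub>G\<^esub> z [^]\<^bsub>G\<^esub> ?k \<in> W}"
      by (rule shrink)
    then obtain W' C' v' c' where
      "P (W', C', v', c') \<and> C' \<subseteq> {z \<in> topspace T. v \<otimes>\<^bsub>G\<^esub> z [^]\<^bsub>G\<^esub> ?k \<in> W}"
      by (elim exE)
    then have "P (W', C', v', c') \<and> R n s (W', C', v', c')"
      using W(2) unfolding R_def s_eq prod.case by blast
    then show "\<exists>s'. P s' \<and> R n s s'" ..
  qed
  then obtain s where s: "\<And>n. P (s n)" "\<And>n. R n (s n) (s (Suc n))" by blast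
  define C where "C n = fst (snd (s n))" for n
  define g where "g n = fst (snd (snd (s n)))" for n
  define c where "c n = snd (snd (snd (s n)))" for n
  have P: "openin T (fst (s n)) \<and> \<one>\<^bsub>G\<^esub> \<in> fst (s n) \<and> fst (s n) \<subseteq> C n \<and> compactin T (C n) \<and>
      g n \<in> fst (s n) \<and> c n \<noteq> 0 \<and> \<phi> (g n) = a [^]\<^bsub>H\<^esub> c n" for n
    using s(1)[of n] by (simp add: P_def C_def g_def c_def case_prod_unfold)
  have maps: "g n \<otimes>\<^bsub>G\<^esub> z [^]\<^bsub>G\<^esub> ((nat \<bar>c n\<bar> + 1) * (n + 2)) \<in> C n" if "z \<in> C (Suc n)" for n z
    using s(2)[of n] that unfolding R_def C_def g_def c_def case_prod_unfold by blast
  have gG: "g n \<in> carrier G" for n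
    using P[of n] openin_subset top by blast
  have "a = \<one>\<^bsub>H\<^esub>"
    by (rule hom_compact_recursion_trivial[OF H G T \<phi> a(1), where C=C and g=g and c=c])
      (use P maps gG in \<open>blast+\<close>)
  then show False using a(2) by simp
qed

text \<open>For \<open>g\<close> outside the kernel, take a neighbourhood \<open>V\<close> avoiding
  the nonzero powers of \<open>\<phi> g\<close>. If \<open>z\<close> is in the kernel, the product
  of the inverse of \<open>z\<close> with \<open>g\<close> is mapped to the first power of
  \<open>\<phi> g\<close>, so it is not in \<open>V\<close>; hence a neighbourhood of
  \<open>g\<close> misses the kernel.\<close>

lemma closedin_kernel:
  assumes H: "aleph1_free H" and G: "topological_group G T" and T: "Hausdorff_space T"
    and lc: "locally_compact_space T" and \<phi>: "\<phi> \<in> hom G H"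
  shows "closedin T (kernel G H \<phi>)"
proof -
  have top: "topspace T = carrier G" using G by (simp add: topological_group_def)
  interpret group_hom G H \<phi>
    using G H \<phi> by (simp add: group_hom_def group_hom_axioms_def topological_group_def
        aleph1_free_def comm_group.axioms(2))
  have "openin T (topspace T - kernel G H \<phi>)"
  proof (subst openin_subopen, intro ballI)
    fix g assume g: "g \<in> topspace T - kernel G H \<phi>"
    then have gG: "g \<in> carrier G" and ne: "\<phi> g \<noteq> \<one>\<^bsub>H\<^esub>" by (auto simp: top kernel_def)
    obtain V where "openin T V \<and> \<one>\<^bsub>G\<^esub> \<in> V \<and>
        (\<forall>v\<in>V. \<forall>c::int. \<phi> v = \<phi> g [^]\<^bsub>H\<^esub> c \<longrightarrow> c = 0)"
      using hom_avoids_cyclic_subgroup[OF H G T lc \<phi> hom_closed[OF gG] ne] ..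
    then have V: "openin T V" "\<one>\<^bsub>G\<^esub> \<in> V"
      "\<And>v c::int. v \<in> V \<Longrightarrow> \<phi> v = \<phi> g [^]\<^bsub>H\<^esub> c \<Longrightarrow> c = 0" by auto
    have "continuous_map T T (\<lambda>z. inv\<^bsub>G\<^esub> z \<otimes>\<^bsub>G\<^esub> g)"
      by (intro topological_group_continuous_mult[OF G] topological_group_continuous_inv[OF G])
        (use gG top in auto)
    then have "openin T {z \<in> topspace T. inv\<^bsub>G\<^esub> z \<otimes>\<^bsub>G\<^esub> g \<in> V}"
      using V(1) by (rule openin_continuous_map_preimage)
    moreover have "inv\<^bsub>G\<^esub> z \<otimes>\<^bsub>G\<^esub> g \<notin> V" if "z \<in> kernel G H \<phi>" for z
    proof
      assume "inv\<^bsub>G\<^esub> z \<otimes>\<^bsub>G\<^esub> g \<in> V"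
      moreover have "\<phi> (inv\<^bsub>G\<^esub> z \<otimes>\<^bsub>G\<^esub> g) = \<phi> g [^]\<^bsub>H\<^esub> (1::int)"
        using that gG by (simp add: kernel_def)
      ultimately have "(1::int) = 0" by (rule V(3))
      then show False by simp
    qed
    ultimately show "\<exists>U. openin T U \<and> g \<in> U \<and> U \<subseteq> topspace T - kernel G H \<phi>"
      using V(2) gG top by (intro exI[of _ "{z \<in> topspace T. inv\<^bsub>G\<^esub> z \<otimes>\<^bsub>G\<^esub> g \<in> V}"]) auto
  qed
  moreover have "kernel G H \<phi> \<subseteq> topspace T" by (auto simp: kernel_def top)
  ultimately show ?thesis by (simp add: closedin_def)
qed

section \<open>Discreteness when the homomorphism is injective\<close>

text \<open>If all powers stayed in \<open>K\<close>, their closure would be a compact set stable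
  under multiplying a power of its elements by \<open>g\<close>. The compact recursion with constant
  data, \<open>a = \<phi> g\<close> and all exponents \<open>c\<close> equal to 1, would make
  \<open>\<phi> g\<close> trivial.\<close>

lemma escaping_powers:
  assumes H: "aleph1_free H" and G: "topological_group G T" and T: "Hausdorff_space T"
    and \<phi>: "\<phi> \<in> hom G H" and K: "compactin T K" and g: "g \<in> carrier G" "\<phi> g \<noteq> \<one>\<^bsub>H\<^esub>"
  shows "\<exists>n::nat. g [^]\<^bsub>G\<^esub> n \<notin> K"
proof (rule ccontr)
  assume neg: "\<not> ?thesis"
  interpret group_hom G H \<phi>
    using G H \<phi> by (simp add: group_hom_def group_hom_axioms_def topological_group_def
        aleph1_free_def comm_group.axioms(2))
  have top: "topspace T = carrier G" using G by (simp add: topological_group_def)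
  define P where "P = range (\<lambda>n::nat. g [^]\<^bsub>G\<^esub> n)"
  define C where "C = T closure_of P"
  have "C \<subseteq> K"
    using neg compactin_imp_closedin[OF T K] unfolding C_def P_def
    by (intro closure_of_minimal) auto
  then have "compactin T C"
    using closed_compactin[OF K] by (simp add: C_def)
  moreover have "P \<subseteq> C"
    unfolding C_def by (rule closure_of_subset) (use g top in \<open>auto simp: P_def\<close>)
  then have "C \<noteq> {}" by (auto simp: P_def)
  moreover have "g \<otimes>\<^bsub>G\<^esub> z [^]\<^bsub>G\<^esub> k \<in> C" if "z \<in> C" for z and k :: nat
  proof -
    have cont: "continuous_map T T (\<lambda>z. g \<otimes>\<^bsub>G\<^esub> z [^]\<^bsub>G\<^esub> k)"
      by (intro topological_group_continuous_mult[OF G] topological_group_continuous_nat_pow[OF G])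
        (use g top in auto)
    \<comment> \<open>Stability is checked on the powers themselves; continuity carries it to the
      closure.\<close>
    have "g \<otimes>\<^bsub>G\<^esub> (g [^]\<^bsub>G\<^esub> n) [^]\<^bsub>G\<^esub> k = g [^]\<^bsub>G\<^esub> Suc (n * k)" for n :: nat
      by (metis G.nat_pow_Suc2 G.nat_pow_pow g(1))
    then have "(\<lambda>z. g \<otimes>\<^bsub>G\<^esub> z [^]\<^bsub>G\<^esub> k) ` P \<subseteq> P"
      unfolding P_def by blast
    then have "T closure_of ((\<lambda>z. g \<otimes>\<^bsub>G\<^esub> z [^]\<^bsub>G\<^esub> k) ` P) \<subseteq> C"
      unfolding C_def by (rule closure_of_mono)
    then show ?thesis
      using continuous_map_image_closure_subset[OF cont, of P] that unfolding C_def by blast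
  qed
  ultimately have "\<phi> g = \<one>\<^bsub>H\<^esub>"
    by (intro hom_compact_recursion_trivial[OF H G T \<phi>, where C="\<lambda>_. C" and g="\<lambda>_. g" and c="\<lambda>_. 1"])
      (use g in \<open>simp_all del: nat_pow_Suc add_2_eq_Suc'\<close>)
  then show False using g(2) by contradiction
qed

text \<open>Otherwise nontrivial elements near the identity have powers that first leave a fixed
  neighbourhood \<open>V\<close> inside a compact set. A cluster point of these exits has roots of
  all orders, so injectivity makes it the identity, although it lies outside
  \<open>V\<close>.\<close>

lemma one_open_of_inj_hom:
  assumes H: "aleph1_free H" and G: "topological_group G T" and T: "Hausdorff_space T"
    and lc: "locally_compact_space T"
    and \<phi>: "\<phi> \<in> hom G H" and inj: "inj_on \<phi> (carrier G)"
  shows "openin T {\<one>\<^bsub>G\<^esub>}"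
proof (rule ccontr)
  assume not_open: "\<not> ?thesis"
  interpret group_hom G H \<phi>
    using G H \<phi> by (simp add: group_hom_def group_hom_axioms_def topological_group_def
        aleph1_free_def comm_group.axioms(2))
  have top: "topspace T = carrier G" using G by (simp add: topological_group_def)
  have ne: "\<phi> g \<noteq> \<one>\<^bsub>H\<^esub>" if "g \<in> carrier G" "g \<noteq> \<one>\<^bsub>G\<^esub>" for g
    using inj that by (metis G.one_closed hom_one inj_onD)
  obtain U K where UK: "openin T U" "compactin T K" "\<one>\<^bsub>G\<^esub> \<in> U" "U \<subseteq> K"
    using lc top G.one_closed unfolding locally_compact_space_def by metis
  \<comment> \<open>With products of two elements of \<open>V\<close> lying in \<open>U\<close>, the
    first power leaving \<open>V\<close> is still in \<open>U\<close>, hence in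
    \<open>K\<close>.\<close>
  obtain V where V: "openin T V" "\<one>\<^bsub>G\<^esub> \<in> V" "\<And>u v. u \<in> V \<Longrightarrow> v \<in> V \<Longrightarrow> u \<otimes>\<^bsub>G\<^esub> v \<in> U"
    using topological_group_square_nhd[OF G UK(1,3)] by blast
  have VG: "V \<subseteq> carrier G" using V(1) openin_subset top by blast
  have "V \<subseteq> K"
    using V(2,3) VG UK(4) by (metis G.r_one subset_iff)
  define S where "S = K - V"
  have "S = K \<inter> (topspace T - V)"
    using compactin_subset_topspace[OF UK(2)] by (auto simp: S_def)
  then have S: "compactin T S"
    using compact_Int_closedin[OF UK(2)] V(1) by blast
  \<comment> \<open>the first powers outside \<open>V\<close> of elements of \<open>W\<close>\<close>
  define E where "E W = {z \<in> S. \<exists>g\<in>W. \<exists>n::nat. z = g [^]\<^bsub>G\<^esub> n \<and> (\<forall>j<n. g [^]\<^bsub>G\<^esub> j \<in> V)}" for W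
  have E_ne: "E W \<noteq> {}" if W: "openin T W" "\<one>\<^bsub>G\<^esub> \<in> W" for W
  proof -
    have "openin T (W \<inter> V)" using W(1) V(1) by blast
    then have "W \<inter> V \<noteq> {\<one>\<^bsub>G\<^esub>}" using not_open by auto
    then obtain g where g: "g \<in> W" "g \<in> V" "g \<noteq> \<one>\<^bsub>G\<^esub>" using W(2) V(2) by blast
    then have gG: "g \<in> carrier G" using VG by blast
    have "\<exists>n::nat. g [^]\<^bsub>G\<^esub> n \<notin> V"
      using escaping_powers[OF H G T \<phi> UK(2) gG ne[OF gG g(3)]] \<open>V \<subseteq> K\<close> by blast
    then obtain n :: nat where n: "g [^]\<^bsub>G\<^esub> n \<notin> V" "\<And>j. j < n \<Longrightarrow> g [^]\<^bsub>G\<^esub> j \<in> V"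
      using exists_least_iff[of "\<lambda>n::nat. g [^]\<^bsub>G\<^esub> n \<notin> V"] by blast
    \<comment> \<open>The exit exponent is positive because the power with exponent 0 is the
      identity, which lies in \<open>V\<close>.\<close>
    then obtain m where m: "n = Suc m" using V(2) by (cases n) auto
    have "g [^]\<^bsub>G\<^esub> n \<in> U" using V(3)[OF n(2)[of m] g(2)] by (simp add: m)
    then have "g [^]\<^bsub>G\<^esub> n \<in> S" using UK(4) n(1) by (auto simp: S_def)
    then have "g [^]\<^bsub>G\<^esub> n \<in> E W" using g(1) n(2) by (auto simp: E_def)
    then show ?thesis by blast
  qed
  define \<W> where "\<W> = {W. openin T W \<and> \<one>\<^bsub>G\<^esub> \<in> W}"
  have "S \<inter> \<Inter>((\<lambda>W. T closure_of E W) ` \<W>) \<noteq> {}"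
  proof -
    have "S \<inter> \<Inter>\<F> \<noteq> {}" if fin: "finite \<F>" "\<F> \<subseteq> (\<lambda>W. T closure_of E W) ` \<W>" for \<F>
    proof -
      obtain I where I: "finite I" "I \<subseteq> \<W>" "\<F> = (\<lambda>W. T closure_of E W) ` I"
        using fin by (meson finite_subset_image)
      \<comment> \<open>\<open>E\<close> is monotone, so the nonempty \<open>E W0\<close> lies in
        each of the finitely many \<open>E W\<close>. Inserting \<open>topspace T\<close> covers the
        case of an empty family.\<close>
      define W0 where "W0 = \<Inter>(insert (topspace T) I)"
      have "openin T W0"
        unfolding W0_def by (rule openin_Inter) (use I in \<open>auto simp: \<W>_def\<close>)
      moreover have "\<one>\<^bsub>G\<^esub> \<in> W0"
        using I(2) top by (auto simp: \<W>_def W0_def)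
      ultimately obtain z where z: "z \<in> E W0" using E_ne by blast
      have zS: "z \<in> S" using z by (auto simp: E_def)
      then have "z \<in> topspace T" using compactin_subset_topspace[OF S] by blast
      moreover have "z \<in> E W" if "W \<in> I" for W
        using z that by (auto simp: E_def W0_def)
      ultimately have "z \<in> T closure_of E W" if "W \<in> I" for W
        using that by (meson closure_of_subset_Int IntI subsetD)
      then show ?thesis using zS I(3) by blast
    qed
    moreover have "closedin T D" if "D \<in> (\<lambda>W. T closure_of E W) ` \<W>" for D
      using that by auto
    ultimately show ?thesis
      by (intro compactin_fip[THEN iffD1, OF S, THEN conjunct2, rule_format] conjI) blast+
  qed
  then obtain x where xS: "x \<in> S" and x: "\<And>W. W \<in> \<W> \<Longrightarrow> x \<in> T closure_of E W" by blast
  have xG: "x \<in> carrier G" using xS compactin_subset_topspace[OF S] top by blast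
  have root: "\<exists>y\<in>K. y [^]\<^bsub>G\<^esub> M = x" if "M > 0" for M :: nat
  proof (rule ccontr)
    assume no_root: "\<not> ?thesis"
    \<comment> \<open>The \<open>M\<close>-th powers of elements of \<open>K\<close> form a compact,
      hence closed, set. If \<open>x\<close> were outside it, so would be every point near
      \<open>x\<close> divided by a point near the identity.\<close>
    define Q where "Q = (\<lambda>y. y [^]\<^bsub>G\<^esub> M) ` K"
    have "compactin T Q"
      unfolding Q_def using UK(2) by (rule image_compactin)
        (intro topological_group_continuous_nat_pow[OF G], simp)
    then have "openin T (topspace T - Q)"
      using compactin_imp_closedin[OF T] by blast
    moreover have "x \<otimes>\<^bsub>G\<^esub> inv\<^bsub>G\<^esub> \<one>\<^bsub>G\<^esub> \<in> topspace T - Q"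
      using no_root xG top by (auto simp: Q_def)
    ultimately obtain A B where AB: "openin T A" "openin T B" "x \<in> A" "\<one>\<^bsub>G\<^esub> \<in> B"
      "\<And>u v. u \<in> A \<Longrightarrow> v \<in> B \<Longrightarrow> u \<otimes>\<^bsub>G\<^esub> inv\<^bsub>G\<^esub> v \<in> topspace T - Q"
      using topological_group_diff_nhds[OF G _ xG G.one_closed] by metis
    \<comment> \<open>All remainders \<open>r < M\<close> are handled at once: \<open>g\<close> in
      \<open>W\<close> has each of these powers in \<open>B\<close>. The intersection is finite, and
      nonempty as a family because \<open>M > 0\<close>.\<close>
    define W where "W = (\<Inter>r\<in>{..<M}. {g \<in> topspace T. g [^]\<^bsub>G\<^esub> r \<in> B})"
    have "openin T {g \<in> topspace T. g [^]\<^bsub>G\<^esub> r \<in> B}" for r :: nat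
      using AB(2) by (intro openin_continuous_map_preimage[where Y=T]
          topological_group_continuous_nat_pow[OF G]) simp_all
    then have "openin T W"
      unfolding W_def using \<open>M > 0\<close> by (intro openin_Inter) auto
    then have "W \<in> \<W>"
      using AB(4) top by (auto simp: \<W>_def W_def)
    then obtain z where z: "z \<in> E W" "z \<in> A"
      using x[of W] AB(1,3) unfolding in_closure_of by blast
    then obtain g and n :: nat where g: "g \<in> W" "z = g [^]\<^bsub>G\<^esub> n" "\<And>j. j < n \<Longrightarrow> g [^]\<^bsub>G\<^esub> j \<in> V"
      and zS: "z \<in> S" by (auto simp: E_def)
    have gG: "g \<in> carrier G" using g(1) \<open>M > 0\<close> top by (auto simp: W_def)
    \<comment> \<open>Removing the power with the remainder \<open>r\<close> from \<open>z\<close>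
      leaves the \<open>M\<close>-th power of the \<open>q\<close>-th power of
      \<open>g\<close>.\<close>
    define q r where "q = n div M" and "r = n mod M"
    have "r < M" using \<open>M > 0\<close> by (simp add: r_def)
    then have "g [^]\<^bsub>G\<^esub> r \<in> B" using g(1) by (auto simp: W_def)
    then have "z \<otimes>\<^bsub>G\<^esub> inv\<^bsub>G\<^esub> (g [^]\<^bsub>G\<^esub> r) \<notin> Q" using AB(5)[OF z(2)] by blast
    moreover have "z = (g [^]\<^bsub>G\<^esub> q) [^]\<^bsub>G\<^esub> M \<otimes>\<^bsub>G\<^esub> g [^]\<^bsub>G\<^esub> r"
      by (simp add: g(2) gG G.nat_pow_pow G.nat_pow_mult q_def r_def)
    then have "z \<otimes>\<^bsub>G\<^esub> inv\<^bsub>G\<^esub> (g [^]\<^bsub>G\<^esub> r) = (g [^]\<^bsub>G\<^esub> q) [^]\<^bsub>G\<^esub> M"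
      using gG by (simp add: G.m_assoc)
    \<comment> \<open>Before the exit the powers lie in \<open>V\<close>; the case
      \<open>q = n\<close>, as for \<open>M = 1\<close>, is the exit point itself, which lies in
      \<open>S\<close>.\<close>
    moreover have "g [^]\<^bsub>G\<^esub> q \<in> K"
    proof (cases "q < n")
      case True
      then show ?thesis using g(3) \<open>V \<subseteq> K\<close> by blast
    next
      case False
      then have "q = n" by (simp add: q_def antisym)
      then show ?thesis using zS g(2) by (simp add: S_def)
    qed
    ultimately show False by (auto simp: Q_def)
  qed
  have "\<phi> x = \<one>\<^bsub>H\<^esub>"
  proof (rule aleph1_free_infinitely_divisible[OF H hom_closed[OF xG]])
    fix M :: nat assume "M > 0"
    then obtain y where "y \<in> K" "y [^]\<^bsub>G\<^esub> M = x" using root by blast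
    moreover have "y \<in> carrier G"
      using \<open>y \<in> K\<close> compactin_subset_topspace[OF UK(2)] top by blast
    ultimately have "\<phi> y \<in> carrier H" "\<phi> y [^]\<^bsub>H\<^esub> M = \<phi> x"
      using hom_nat_pow by auto
    then show "\<exists>h\<in>carrier H. h [^]\<^bsub>H\<^esub> M = \<phi> x" by blast
  qed
  then have "x = \<one>\<^bsub>G\<^esub>" using ne[OF xG] by blast
  then show False using xS V(2) by (simp add: S_def)
qed

section \<open>The quotient topology on the image\<close>

lemma quotient_topology_exists: "\<exists>T'. quotient_map T T' f"
proof -
  \<comment> \<open>These are the open sets of the final topology along \<open>f\<close> on the
    image of the space.\<close>
  define P where "P U \<longleftrightarrow> U \<subseteq> f ` topspace T \<and> openin T {x \<in> topspace T. f x \<in> U}" for U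
  have "istopology P"
    unfolding istopology_def
  proof (intro conjI allI impI)
    fix A B assume "P A" "P B"
    moreover have "{x \<in> topspace T. f x \<in> A \<inter> B} = {x \<in> topspace T. f x \<in> A} \<inter> {x \<in> topspace T. f x \<in> B}"
      by auto
    ultimately show "P (A \<inter> B)" by (auto simp only: P_def intro: openin_Int)
  next
    fix \<K> assume "\<forall>K\<in>\<K>. P K"
    moreover have "{x \<in> topspace T. f x \<in> \<Union>\<K>} = (\<Union>K\<in>\<K>. {x \<in> topspace T. f x \<in> K})"
      by auto
    ultimately show "P (\<Union>\<K>)" by (auto simp only: P_def intro: openin_Union)
  qed
  then have op: "openin (topology P) = P" by (rule topology_inverse')
  have "P (f ` topspace T)"
    by (auto simp: P_def intro: back_subst[of "openin T", OF openin_topspace])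
  then have "topspace (topology P) = f ` topspace T"
    unfolding topspace_def[of "topology P"] op by (auto simp only: P_def)
  then have "quotient_map T (topology P) f"
    by (simp add: quotient_map_def op P_def)
  then show ?thesis ..
qed

text \<open>The saturation of an open set is a union of its translates by kernel elements, hence
  open.\<close>

lemma (in group_hom) quotient_map_hom_open:
  assumes G: "topological_group G T" and q: "quotient_map T T' h"
  shows "open_map T T' h"
  unfolding open_map_def
proof (intro allI impI)
  fix W assume W: "openin T W"
  have top: "topspace T = carrier G" using G by (simp add: topological_group_def)
  have "openin T {x \<in> topspace T. h x \<in> h ` W}"
  proof (subst openin_subopen, intro ballI)
    fix x assume "x \<in> {x \<in> topspace T. h x \<in> h ` W}"
    then obtain w where x: "x \<in> carrier G" "w \<in> W" "h x = h w" by (auto simp: top)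
    then have w: "w \<in> carrier G" using W openin_subset top by blast
    define k where "k = w \<otimes> inv x"
    have k: "k \<in> carrier G" "k \<otimes> x = w" "h k = \<one>\<^bsub>H\<^esub>"
      using x w by (simp_all add: k_def G.m_assoc)
    have "openin T {y \<in> topspace T. k \<otimes> y \<in> W}"
      using W by (intro openin_continuous_map_preimage[where Y=T]
          topological_group_continuous_mult[OF G]) (use k top in auto)
    moreover have "h y \<in> h ` W" if "y \<in> carrier G" "k \<otimes> y \<in> W" for y
      using that k by (intro image_eqI[of _ _ "k \<otimes> y"]) auto
    ultimately show "\<exists>U. openin T U \<and> x \<in> U \<and> U \<subseteq> {x \<in> topspace T. h x \<in> h ` W}"
      using k x top by (intro exI[of _ "{y \<in> topspace T. k \<otimes> y \<in> W}"]) auto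
  qed
  moreover have "h ` W \<subseteq> topspace T'"
    using q openin_subset[OF W] by (auto simp: quotient_map_def)
  ultimately show "openin T' (h ` W)"
    using q unfolding quotient_map_def by blast
qed

lemma open_map_prod_map:
  assumes f: "open_map S S' f" and g: "open_map T T' g"
  shows "open_map (prod_topology S T) (prod_topology S' T') (\<lambda>(x, y). (f x, g y))"
  unfolding open_map_def
proof (intro allI impI)
  fix W assume W: "openin (prod_topology S T) W"
  show "openin (prod_topology S' T') ((\<lambda>(x, y). (f x, g y)) ` W)"
    unfolding openin_prod_topology_alt
  proof (intro allI impI)
    fix u v assume "(u, v) \<in> (\<lambda>(x, y). (f x, g y)) ` W"
    then obtain x y where xy: "(x, y) \<in> W" "u = f x" "v = g y" by auto
    obtain A B where AB: "openin S A" "openin T B" "x \<in> A" "y \<in> B" "A \<times> B \<subseteq> W"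
      using W[unfolded openin_prod_topology_alt, rule_format, OF xy(1)] by (elim exE conjE)
    have "openin S' (f ` A)" "openin T' (g ` B)"
      using f g AB(1,2) by (simp_all add: open_map_def)
    moreover have "f ` A \<times> g ` B \<subseteq> (\<lambda>(x, y). (f x, g y)) ` W"
      using AB(5) by force
    ultimately show "\<exists>U V. openin S' U \<and> openin T' V \<and> u \<in> U \<and> v \<in> V \<and>
        U \<times> V \<subseteq> (\<lambda>(x, y). (f x, g y)) ` W"
      using AB(3,4) xy(2,3) by (intro exI[of _ "f ` A"] exI[of _ "g ` B"]) simp
  qed
qed

text \<open>The operations on the image are continuous because they are so after composition with
  quotient maps. For multiplication this needs the product of \<open>h\<close> with itself to be a
  quotient map, which follows from openness of \<open>h\<close>; a product of quotient maps need not
  be one in general.\<close>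

lemma (in group_hom) topological_group_quotient:
  assumes G: "topological_group G T" and q: "quotient_map T T' h"
  shows "topological_group (H\<lparr>carrier := h ` carrier G\<rparr>) T'"
proof -
  have top: "topspace T = carrier G" using G by (simp add: topological_group_def)
  have top': "topspace T' = h ` carrier G" using q top by (simp add: quotient_map_def)
  have cont: "continuous_map T T' h" using q by (rule quotient_imp_continuous_map)
  have sub: "subgroup (h ` carrier G) H"
    by (rule subgroup_img_is_subgroup[OF G.subgroup_self])
  have "quotient_map (prod_topology T T) (prod_topology T' T') (\<lambda>(x, y). (h x, h y))"
  proof (rule continuous_open_imp_quotient_map)
    show "continuous_map (prod_topology T T) (prod_topology T' T') (\<lambda>(x, y). (h x, h y))"
      using cont by (simp add: continuous_map_prod_top)
    show "open_map (prod_topology T T) (prod_topology T' T') (\<lambda>(x, y). (h x, h y))"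
      by (intro open_map_prod_map quotient_map_hom_open[OF G q])
    show "(\<lambda>(x, y). (h x, h y)) ` topspace (prod_topology T T) = topspace (prod_topology T' T')"
      by (force simp: top top')
  qed
  moreover have "continuous_map (prod_topology T T) T'
      ((\<lambda>(x, y). x \<otimes>\<^bsub>H\<^esub> y) \<circ> (\<lambda>(x, y). (h x, h y)))"
  proof (rule continuous_map_eq)
    show "continuous_map (prod_topology T T) T' (h \<circ> (\<lambda>(x, y). x \<otimes> y))"
      using G cont by (intro continuous_map_compose) (auto simp: topological_group_def)
  qed (auto simp: top)
  ultimately have "continuous_map (prod_topology T' T') T' (\<lambda>(x, y). x \<otimes>\<^bsub>H\<^esub> y)"
    by (rule continuous_compose_quotient_map)
  moreover have "continuous_map T T' ((\<lambda>x. inv\<^bsub>H\<^esub> x) \<circ> h)"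
  proof (rule continuous_map_eq)
    show "continuous_map T T' (h \<circ> (\<lambda>x. inv x))"
      using G cont by (intro continuous_map_compose) (auto simp: topological_group_def)
  qed (auto simp: top)
  then have "continuous_map T' T' (\<lambda>x. inv\<^bsub>H\<^esub> x)"
    by (rule continuous_compose_quotient_map[OF q])
  then have "continuous_map T' T' (\<lambda>x. inv\<^bsub>H\<lparr>carrier := h ` carrier G\<rparr>\<^esub> x)"
    by (rule continuous_map_eq) (simp add: top' H.m_inv_consistent[OF sub])
  ultimately show ?thesis
    using subgroup.subgroup_is_group[OF sub H.is_group] top'
    by (simp add: topological_group_def)
qed

text \<open>Points with different images have their quotient in the open complement of the kernel.
  Boxes on which this persists have disjoint images, and these are open.\<close>

lemma (in group_hom) Hausdorff_quotient:
  assumes G: "topological_group G T" and q: "quotient_map T T' h"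
    and cl: "closedin T (kernel G H h)"
  shows "Hausdorff_space T'"
  unfolding Hausdorff_space_def
proof (intro allI impI)
  have top: "topspace T = carrier G" using G by (simp add: topological_group_def)
  fix u v assume uv: "u \<in> topspace T' \<and> v \<in> topspace T' \<and> u \<noteq> v"
  moreover have "topspace T' = h ` carrier G" using q top by (simp add: quotient_map_def)
  ultimately obtain x y where xy: "x \<in> carrier G" "y \<in> carrier G" "u = h x" "v = h y"
    by auto
  have ker: "a \<otimes> inv b \<in> kernel G H h" if "a \<in> carrier G" "b \<in> carrier G" "h a = h b" for a b
    using that by (simp add: kernel_def)
  have "h (x \<otimes> inv y) \<noteq> \<one>\<^bsub>H\<^esub>"
    using xy uv H.inv_equality[of "h x" "inv\<^bsub>H\<^esub> h y"] by auto
  then have "x \<otimes> inv y \<in> topspace T - kernel G H h"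
    using xy top by (simp add: kernel_def)
  moreover have "openin T (topspace T - kernel G H h)" using cl by blast
  ultimately obtain A B where AB: "openin T A" "openin T B" "x \<in> A" "y \<in> B"
    "\<And>a b. a \<in> A \<Longrightarrow> b \<in> B \<Longrightarrow> a \<otimes> inv b \<in> topspace T - kernel G H h"
    using topological_group_diff_nhds[OF G _ xy(1,2)] by metis
  have "A \<subseteq> carrier G" "B \<subseteq> carrier G" using AB(1,2) openin_subset top by blast+
  then have "h a \<noteq> h b" if "a \<in> A" "b \<in> B" for a b
    using AB(5)[OF that] ker[of a b] that by auto
  then have "disjnt (h ` A) (h ` B)"
    by (auto simp: disjnt_iff)
  moreover have "openin T' (h ` A)" "openin T' (h ` B)"
    using quotient_map_hom_open[OF G q] AB(1,2) by (simp_all add: open_map_def)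
  ultimately show "\<exists>U V. openin T' U \<and> openin T' V \<and> u \<in> U \<and> v \<in> V \<and> disjnt U V"
    using AB(3,4) xy(3,4) by (intro exI[of _ "h ` A"] exI[of _ "h ` B"]) simp
qed

section \<open>Reduction to the injective case\<close>

theorem theoremB:
  fixes H :: "('h, 'n) monoid_scheme"
    and G :: "('g, 'm) monoid_scheme"
    and T :: "'g topology"
    and \<phi> :: "'g \<Rightarrow> 'h"
  assumes "aleph1_free H"
    and "topological_group G T"
    and "locally_compact_space T"
    and "Hausdorff_space T"
    and "\<phi> \<in> hom G H"
  shows "openin T (kernel G H \<phi>)"
proof -
  interpret group_hom G H \<phi>
    using assms by (simp add: group_hom_def group_hom_axioms_def topological_group_def
        aleph1_free_def comm_group.axioms(2))
  have top: "topspace T = carrier G" using assms(2) by (simp add: topological_group_def)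
  obtain T' where q: "quotient_map T T' \<phi>" using quotient_topology_exists ..
  define Q where "Q = H\<lparr>carrier := \<phi> ` carrier G\<rparr>"
  have "closedin T (kernel G H \<phi>)"
    by (rule closedin_kernel[OF assms(1,2,4,3,5)])
  then have "Hausdorff_space T'" by (rule Hausdorff_quotient[OF assms(2) q])
  moreover have "topological_group Q T'"
    unfolding Q_def by (rule topological_group_quotient[OF assms(2) q])
  moreover have "locally_compact_space T'"
    using quotient_imp_continuous_map[OF q] quotient_map_hom_open[OF assms(2) q] _ assms(3)
    by (rule locally_compact_space_continuous_open_map_image) (use q in \<open>simp add: quotient_map_def\<close>)
  \<comment> \<open>The inclusion of the image into \<open>H\<close> is the injective homomorphism
    to which the discreteness result applies; the kernel of \<open>\<phi>\<close> is then the
    preimage of an open point.\<close>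
  moreover have "id \<in> hom Q H" by (auto simp: Q_def hom_def)
  ultimately have "openin T' {\<one>\<^bsub>Q\<^esub>}"
    using one_open_of_inj_hom[OF assms(1), of Q T' id] by simp
  then have "openin T {x \<in> topspace T. \<phi> x \<in> {\<one>\<^bsub>Q\<^esub>}}"
    by (rule openin_continuous_map_preimage[OF quotient_imp_continuous_map[OF q]])
  then show ?thesis by (simp add: kernel_def top Q_def)
qed

end
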